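(* Let $f,g\in\mathcal{C}^1(\mathbb{R}^2)$ be supported in $\frac12\mathbb{B}=\{\mathbf{x}\in\mathbb{R}^2:\|\mathbf{x}\|_2\le \frac12\}$ and let $(m,n)\in\mathbb{Z}\times\mathbb{N}$. Then $$\left|C_{m,n}^{K}[f,g]-C_{m,n}^{K}(f\ast g)\right|=\mathcal{O}(1/K),$$ that is, there is a constant $A>0$ such that the left-hand side is at most $A/K$ for every $K\in\mathbb{N}$.
   Context: $\mathbb{N}=\{1,2,\dots\}$. $\mathrm{supp}(f)=\{\mathbf{x}: f(\mathbf{x})\neq 0\}$ and $f$ is supported in $X$ if $\mathrm{supp}(f)\subseteq X$. $\mathcal{C}^1(\mathbb{R}^2)$ is the set of functions $\mathbb{R}^2\to\mathbb{C}$ all of whose partial derivatives of order $\le 1$ exist and are continuous. $(f\ast g)(\mathbf{x})=\int_{\mathbb{R}^2}f(\mathbf{y})g(\mathbf{x}-\mathbf{y})\,d\mathbf{y}$. Bessel notation: $J_m$ is the Bessel function of the first kind of order $m\in\mathbb{Z}$, and $0<z_{m,1}<z_{m,2}<\cdots$ are its positive zeros. Finite Fourier transform: for $L\in\mathbb{N}$, $\mathbf{k}\in\mathbb{Z}^2$, $\widehat f(\mathbf{k};L)=\delta^2\sum_{i=1}^L\sum_{j=1}^L f(x_i,x_j)e^{-\pi\mathrm{i}(k_1x_i+k_2x_j)}$ with $\delta=2/L$, $x_i=-1+(i-1)\delta$. Coefficients: for $\mathbf{k}=(k_1,k_2)\in\mathbb{Z}^2$, $\mathbf{c}(\mathbf{k};m,n)=\varepsilon_m\sqrt{\pi}(-1)^n\mathrm{i}^m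 z_{m,n}\frac{J_m(\pi\|\mathbf{k}\|_2)e^{-\mathrm{i}m\Phi(\mathbf{k})}}{2(\pi^2\|\mathbf{k}\|_2^2-z_{m,n}^2)}$, where $\varepsilon_m=1$ if $m\ge0$, $\varepsilon_m=(-1)^m$ if $m<0$, and $\Phi(\mathbf{k})=\mathrm{atan2}(k_2,k_1)$ is the polar angle of $\mathbf{k}$ (with value $0$ at $\mathbf{k}=0$). If $\pi\|\mathbf{k}\|_2=z_{m,n}$, the quotient $J_m(\pi\|\mathbf{k}\|_2)/(\pi^2\|\mathbf{k}\|_2^2-z_{m,n}^2)$ is understood as its limiting value $J_m'(z_{m,n})/(2z_{m,n})$. For $K\in\mathbb{N}$: $C_{m,n}^K(h)=\sum_{\mathbf{k}\in\mathbb{Z}^2,\ \|\mathbf{k}\|_\infty\le K}\mathbf{c}(\mathbf{k};m,n)\,\widehat h(\mathbf{k};2K+1)$ and $C_{m,n}^K[f,g]=\sum_{\mathbf{k}\in\mathbb{Z}^2,\ \|\mathbf{k}\|_\infty\le K}\mathbf{c}(\mathbf{k};m,n)\,\widehat f(\mathbf{k};2K+1)\,\widehat g(\mathbf{k};2K+1)$. *)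

theory Defs
  imports "HOL-Analysis.Analysis"
begin

section \<open>Functions on the plane\<close>

definition C1_plane :: "(real \<times> real \<Rightarrow> complex) \<Rightarrow> bool" where
  "C1_plane f \<longleftrightarrow> continuous_on UNIV f \<and>
     (\<exists>f1 f2. continuous_on UNIV f1 \<and> continuous_on UNIV f2 \<and>
        (\<forall>x y. ((\<lambda>t. f (t, y)) has_vector_derivative f1 (x, y)) (at x) \<and>
               ((\<lambda>t. f (x, t)) has_vector_derivative f2 (x, y)) (at y)))"

text \<open>Following the source, no closure is taken.\<close>

definition supp :: "(real \<times> real \<Rightarrow> complex) \<Rightarrow> (real \<times> real) set" where
  "supp f = {x. f x \<noteq> 0}"

definition convolution ::
    "(real \<times> real \<Rightarrow> complex) \<Rightarrow> (real \<times> real \<Rightarrow> complex) \<Rightarrow> real \<times> real \<Rightarrow> complex" where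
  "convolution f g x = (LINT y|lborel. f y * g (x - y))"

section \<open>Bessel functions of integer order\<close>

text \<open>
  The usual ascending series, with the reciprocal Gamma function (an entire function) in place of
  \<open>1 / (l + m)!\<close>. For \<open>m < 0\<close> the terms with \<open>l < - m\<close>, which include all those with a negative
  exponent, vanish because \<open>rGamma\<close> is zero at the nonpositive integers.
\<close>

definition bessel_J :: "int \<Rightarrow> real \<Rightarrow> real" where
  "bessel_J m x =
     (\<Sum>l. (-1) ^ l / fact l * rGamma (of_int (int l + m + 1)) * (x / 2) powi (2 * int l + m))"

text \<open>
  The \<open>n\<close>-th positive zero, for \<open>n \<ge> 1\<close>: the positive zero such that exactly \<open>n\<close> positive zeros
  do not exceed it.
\<close>

definition bessel_zero :: "int \<Rightarrow> nat \<Rightarrow> real" where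
  "bessel_zero m n =
     (THE z. 0 < z \<and> bessel_J m z = 0 \<and> card {x. 0 < x \<and> x \<le> z \<and> bessel_J m x = 0} = n)"

section \<open>Finite Fourier transform\<close>

definition grid_pt :: "nat \<Rightarrow> nat \<Rightarrow> real" where
  "grid_pt L i = -1 + (real i - 1) * (2 / real L)"

definition finite_fourier :: "(real \<times> real \<Rightarrow> complex) \<Rightarrow> int \<times> int \<Rightarrow> nat \<Rightarrow> complex" where
  "finite_fourier f k L =
     of_real ((2 / real L)\<^sup>2) *
     (\<Sum>i=1..L. \<Sum>j=1..L. f (grid_pt L i, grid_pt L j) *
        exp (- (of_real pi * \<i> *
          of_real (of_int (fst k) * grid_pt L i + of_int (snd k) * grid_pt L j))))"

section \<open>Expansion coefficients\<close>

definition freq_norm :: "int \<times> int \<Rightarrow> real" where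
  "freq_norm k = sqrt ((of_int (fst k))\<^sup>2 + (of_int (snd k))\<^sup>2)"

text \<open>\<open>Arg\<close> takes values in the interval from \<open>-pi\<close> (excluded) to \<open>pi\<close> (included), and \<open>Arg 0 = 0\<close>.\<close>

definition freq_angle :: "int \<times> int \<Rightarrow> real" where
  "freq_angle k = Arg (Complex (of_int (fst k)) (of_int (snd k)))"

definition bessel_sign :: "int \<Rightarrow> real" where
  "bessel_sign m = (if m \<ge> 0 then 1 else (-1) powi m)"

text \<open>
  The quotient \<open>J\<^sub>m(r) / (r\<^sup>2 - z\<^sup>2)\<close> at \<open>z = z\<^sub>m\<^sub>,\<^sub>n\<close>, replaced by its limit at the removable
  singularity \<open>r = z\<close>.
\<close>

definition bessel_quot :: "int \<Rightarrow> nat \<Rightarrow> real \<Rightarrow> real" where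
  "bessel_quot m n r =
     (let z = bessel_zero m n in
      if r = z then deriv (bessel_J m) z / (2 * z) else bessel_J m r / (r\<^sup>2 - z\<^sup>2))"

definition coef :: "int \<Rightarrow> nat \<Rightarrow> int \<times> int \<Rightarrow> complex" where
  "coef m n k =
     of_real (bessel_sign m * sqrt pi * (-1) ^ n) * \<i> powi m * of_real (bessel_zero m n) *
     (of_real (bessel_quot m n (pi * freq_norm k)) *
      exp (- (\<i> * of_int m * of_real (freq_angle k))) / 2)"

definition freq_box :: "nat \<Rightarrow> (int \<times> int) set" where
  "freq_box K = {k. max \<bar>fst k\<bar> \<bar>snd k\<bar> \<le> int K}"

definition disk_coef :: "int \<Rightarrow> nat \<Rightarrow> nat \<Rightarrow> (real \<times> real \<Rightarrow> complex) \<Rightarrow> complex" where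
  "disk_coef m n K h = (\<Sum>k\<in>freq_box K. coef m n k * finite_fourier h k (2 * K + 1))"

definition disk_coef_conv ::
    "int \<Rightarrow> nat \<Rightarrow> nat \<Rightarrow> (real \<times> real \<Rightarrow> complex) \<Rightarrow> (real \<times> real \<Rightarrow> complex) \<Rightarrow> complex" where
  "disk_coef_conv m n K f g =
     (\<Sum>k\<in>freq_box K. coef m n k * finite_fourier f k (2 * K + 1) * finite_fourier g k (2 * K + 1))"

text \<open>The box is finite, so the sums above are not silently zero.\<close>

lemma finite_freq_box [simp]: "finite (freq_box K)"
proof -
  have "freq_box K \<subseteq> {- int K..int K} \<times> {- int K..int K}"
    by (auto simp: freq_box_def)
  then show ?thesis
    by (rule finite_subset) simp
qed

end

theory Submission
  imports Defs
begin

text \<open>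
  Put \<open>L = 2K + 1\<close>, \<open>\<delta> = 2 / L\<close>, and cut the plane into cells of side \<open>\<delta>\<close>. Writing the convolution
  integral as a sum over cells shows that the finite Fourier transform of \<open>f \<star> g\<close> is \<^emph>\<open>exactly\<close> the
  average, over \<open>t\<close> in one cell, of products of finite Fourier transforms of translates of \<open>f\<close> and
  \<open>g\<close> by \<open>O(\<delta>)\<close>, times a phase \<open>\<omega>(k)\<close> with \<open>|\<omega>(k) - 1| = O(|k| \<delta>)\<close>. The supports are so small that
  no wrap-around occurs. As \<open>f\<close> and \<open>g\<close> are Lipschitz, the discrete Parseval identity bounds the
  effect of the translations by \<open>O(\<delta>)\<close> in \<open>\<ell>\<^sup>2\<close>, and the phase costs another \<open>O(\<delta>)\<close> because \<open>|k| |c(k)|\<close>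
  is bounded. The latter only needs \<open>|J\<^sub>m| \<le> 1\<close>, which follows from Bessel's integral.
\<close>

section \<open>Bessel functions are bounded by one\<close>

text \<open>The Weierstrass M-test makes the partial sums converge uniformly, and uniform limits
  commute with integration over a compact interval. Stating the limit through \<open>sums\<close>
  allows a closed form to be supplied for \<open>g\<close>.\<close>

lemma integral_sums_uniform:
  fixes f :: "nat \<Rightarrow> real \<Rightarrow> complex"
  assumes cont: "\<And>n. continuous_on {a..b} (f n)"
    and bound: "\<And>n x. x \<in> {a..b} \<Longrightarrow> norm (f n x) \<le> M n"
    and "summable M"
    and sums: "\<And>x. x \<in> {a..b} \<Longrightarrow> (\<lambda>n. f n x) sums g x"
  shows "(\<lambda>n. integral {a..b} (f n)) sums integral {a..b} g"
proof -
  have "uniform_limit {a..b} (\<lambda>n x. \<Sum>i<n. f i x) (\<lambda>x. \<Sum>i. f i x) sequentially"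
    by (rule Weierstrass_m_test) (use bound \<open>summable M\<close> in auto)
  then obtain I J where I: "\<And>n. ((\<lambda>x. \<Sum>i<n. f i x) has_integral I n) {a..b}"
    and J: "((\<lambda>x. \<Sum>i. f i x) has_integral J) {a..b}" and lim: "I \<longlonglongrightarrow> J"
    by (rule uniform_limit_integral) (auto intro!: continuous_on_sum cont)
  have "I = (\<lambda>n. \<Sum>i<n. integral {a..b} (f i))"
  proof
    show "I n = (\<Sum>i<n. integral {a..b} (f i))" for n
      using integral_unique[OF I[of n]] cont
      by (simp add: integral_sum integrable_continuous_interval)
  qed
  moreover have "J = integral {a..b} g"
    using integral_unique[OF J] sums by (auto simp: sums_iff intro!: integral_cong)
  ultimately show ?thesis
    using lim by (simp add: sums_def)
qed

text \<open>Orthogonality of the characters of the circle: for nonzero \<open>n\<close> the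
  antiderivative \<open>cis (n \<theta>) / (\<i> n)\<close> has period 2 pi.\<close>

lemma integral_cis_int:
  "integral {0..2 * pi} (\<lambda>\<theta>. cis (of_int n * \<theta>)) = (if n = 0 then of_real (2 * pi) else 0)"
proof (cases "n = 0")
  case True
  then show ?thesis by (simp add: scaleR_conv_of_real)
next
  case False
  have "((\<lambda>\<theta>. cis (of_int n * \<theta>)) has_integral
      cis (of_int n * (2 * pi)) / (\<i> * of_int n) - cis (of_int n * 0) / (\<i> * of_int n)) {0..2 * pi}"
  proof (rule fundamental_theorem_of_calculus)
    fix \<theta> :: real assume "\<theta> \<in> {0..2 * pi}"
    show "((\<lambda>\<theta>. cis (of_int n * \<theta>) / (\<i> * of_int n)) has_vector_derivative cis (of_int n * \<theta>))
        (at \<theta> within {0..2 * pi})"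
      unfolding has_vector_derivative_complex_iff using False
      by (auto intro!: derivative_eq_intros simp: Re_divide Im_divide power2_eq_square)
  qed simp
  moreover have "cis (of_int n * (2 * pi)) = 1"
    using cis_multiple_2pi[of "of_int n"] by (simp add: mult.commute)
  ultimately show ?thesis
    using False by (simp add: integral_unique)
qed

lemma summable_exp_real: "summable (\<lambda>n. \<bar>a\<bar> ^ n / fact n * c :: real)"
  using summable_exp[of "\<bar>a\<bar>"] by (intro summable_mult2) (simp add: divide_inverse mult.commute)

lemma exp_sums_complex: "(\<lambda>n. z ^ n / fact n) sums exp (z::complex)"
  using exp_converges[of z] by (simp add: scaleR_conv_of_real divide_inverse mult.commute)

lemma norm_exp_times_cis_le: "norm (exp (of_real a * cis \<theta>)) \<le> exp \<bar>a\<bar>"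
proof -
  have "a * cos \<theta> \<le> \<bar>a * cos \<theta>\<bar>" by simp
  also have "\<dots> \<le> \<bar>a\<bar>"
    unfolding abs_mult by (rule mult_left_le) auto
  finally show ?thesis by simp
qed

text \<open>Fourier coefficients of the exponential on a circle: after expansion in powers of
  \<open>cis \<theta>\<close>, orthogonality leaves only the term of exponent \<open>- q\<close>, if
  there is one.\<close>

lemma integral_exp_cis:
  "integral {0..2 * pi} (\<lambda>\<theta>. exp (of_real a * cis \<theta>) * cis (of_int q * \<theta>)) =
    of_real (2 * pi * (if q \<le> 0 then a ^ nat (- q) / fact (nat (- q)) else 0))"
proof -
  let ?f = "\<lambda>n \<theta>. (of_real a * cis \<theta>) ^ n / fact n * cis (of_int q * \<theta>)"
  have term_eq: "?f n \<theta> = of_real (a ^ n / fact n) * cis (of_int (int n + q) * \<theta>)" for n \<theta>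
    by (simp add: power_mult_distrib Complex.DeMoivre cis_mult algebra_simps)
  have "(\<lambda>n. integral {0..2 * pi} (?f n)) sums
      integral {0..2 * pi} (\<lambda>\<theta>. exp (of_real a * cis \<theta>) * cis (of_int q * \<theta>))"
  proof (rule integral_sums_uniform)
    show "summable (\<lambda>n. \<bar>a\<bar> ^ n / fact n * 1)" by (rule summable_exp_real)
    show "(\<lambda>n. ?f n \<theta>) sums (exp (of_real a * cis \<theta>) * cis (of_int q * \<theta>))" for \<theta>
      by (intro sums_mult2 exp_sums_complex)
  qed (auto intro!: continuous_intros simp: norm_mult norm_power norm_divide)
  moreover have "integral {0..2 * pi} (?f n) =
      of_real (if int n = - q then 2 * pi * (a ^ n / fact n) else 0)" for n
    unfolding term_eq using integral_cis_int[of "int n + q"] by simp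
  ultimately have "(\<lambda>n. of_real (if int n = - q then 2 * pi * (a ^ n / fact n) else 0)) sums
      integral {0..2 * pi} (\<lambda>\<theta>. exp (of_real a * cis \<theta>) * cis (of_int q * \<theta>))"
    by simp
  moreover have "(\<lambda>n. complex_of_real (if int n = - q then 2 * pi * (a ^ n / fact n) else 0)) sums
      of_real (2 * pi * (if q \<le> 0 then a ^ nat (- q) / fact (nat (- q)) else 0))"
  proof (cases "q \<le> 0")
    case True
    then have "int n = - q \<longleftrightarrow> n = nat (- q)" for n by auto
    then show ?thesis
      using True sums_single[of "nat (- q)" "\<lambda>n. 2 * pi * (a ^ n / fact n)"]
      unfolding sums_of_real_iff by simp
  next
    case False
    then have "int n \<noteq> - q" for n by simp
    then show ?thesis using False by simp
  qed
  ultimately show ?thesis by (rule sums_unique2)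
qed

text \<open>The second factor on the right is shaped like the value in
  \<open>integral_exp_cis\<close> at \<open>q = - int l - m\<close>. For
  \<open>int l + m < 0\<close> both sides vanish, because \<open>rGamma\<close> is zero at the
  nonpositive integers.\<close>

lemma bessel_term_eq:
  fixes x :: real
  assumes "x > 0"
  shows "(-1) ^ l / fact l * rGamma (of_int (int l + m + 1)) * (x / 2) powi (2 * int l + m) =
    (- (x / 2)) ^ l / fact l *
      (if - int l - m \<le> 0 then (x / 2) ^ nat (int l + m) / fact (nat (int l + m)) else 0)"
proof (cases "int l + m \<ge> 0")
  case True
  then have *: "2 * int l + m = int (l + nat (int l + m))" by simp
  have "(x / 2) powi (2 * int l + m) = (x / 2) ^ (l + nat (int l + m))"
    unfolding * power_int_of_nat by simp
  moreover have "(- (x / 2)) ^ l = (-1) ^ l * (x / 2) ^ l"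
    by (rule power_minus)
  ultimately show ?thesis
    using True by (simp add: rGamma_of_int power_add inverse_eq_divide nat_add_distrib del: of_int_add)
next
  case False
  then show ?thesis by (simp add: rGamma_of_int del: of_int_add)
qed

text \<open>Bessel's integral: with \<open>a = x / 2\<close>, the function \<open>?g\<close> is
  exp(i x sin \<theta>) exp(-i m \<theta>), written as a product of two exponentials whose real
  parts cancel. It has modulus 1, and \<open>bessel_J m x\<close> is its mean over the
  circle.\<close>

lemma abs_bessel_J_le_1:
  assumes "x > 0"
  shows "\<bar>bessel_J m x\<bar> \<le> 1"
proof -
  define a where "a = x / 2"
  let ?E = "\<lambda>\<theta>. exp (of_real a * cis \<theta>)"
  \<comment> \<open>Only the second exponential is expanded. Integrating against the intact first
    one then yields the ascending series term by term, for every integer \<open>m\<close> at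
    once.\<close>
  let ?f = "\<lambda>l \<theta>. ?E \<theta> * ((of_real (- a) * cis (- \<theta>)) ^ l / fact l * cis (of_int (- m) * \<theta>))"
  let ?g = "\<lambda>\<theta>. ?E \<theta> * (exp (of_real (- a) * cis (- \<theta>)) * cis (of_int (- m) * \<theta>))"
  let ?t = "\<lambda>l. (-1) ^ l / fact l * rGamma (of_int (int l + m + 1)) * (x / 2) powi (2 * int l + m)"
  have "(\<lambda>l. integral {0..2 * pi} (?f l)) sums integral {0..2 * pi} ?g"
  proof (rule integral_sums_uniform)
    show "summable (\<lambda>n. \<bar>a\<bar> ^ n / fact n * exp \<bar>a\<bar>)" by (rule summable_exp_real)
    show "(\<lambda>n. ?f n \<theta>) sums ?g \<theta>" for \<theta>
      by (intro sums_mult sums_mult2 exp_sums_complex)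
    show "norm (?f n \<theta>) \<le> \<bar>a\<bar> ^ n / fact n * exp \<bar>a\<bar>" for n \<theta>
      using mult_left_mono[OF norm_exp_times_cis_le[of a \<theta>], of "\<bar>a\<bar> ^ n / fact n"]
      by (simp add: norm_mult norm_power norm_divide mult.commute del: norm_exp_eq_Re)
  qed (auto intro!: continuous_intros)
  moreover have "integral {0..2 * pi} (?f l) = of_real (2 * pi * ?t l)" for l
  proof -
    have "?f l \<theta> = of_real ((- a) ^ l / fact l) * (?E \<theta> * cis (of_int (- int l - m) * \<theta>))" for \<theta>
    proof -
      have "(of_real (- a) * cis (- \<theta>)) ^ l = of_real ((- a) ^ l) * cis (of_int (- int l) * \<theta>)"
        by (simp only: power_mult_distrib Complex.DeMoivre of_real_power) simp
      moreover have "cis (of_int (- int l) * \<theta>) * cis (of_int (- m) * \<theta>) = cis (of_int (- int l - m) * \<theta>)"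
        unfolding cis_mult by (rule arg_cong[where f = cis]) (simp add: algebra_simps)
      ultimately show ?thesis by (simp add: mult_ac)
    qed
    then show ?thesis
      unfolding bessel_term_eq[OF assms]
      by (simp only: integral_mult_right integral_exp_cis) (simp add: a_def add.commute)
  qed
  ultimately have S: "(\<lambda>l. of_real (2 * pi * ?t l)) sums integral {0..2 * pi} ?g"
    by simp
  have "(\<lambda>l. 2 * pi * ?t l) sums Re (integral {0..2 * pi} ?g)"
    using sums_Re[OF S] by (simp only: Re_complex_of_real)
  then have "(\<lambda>l. 2 * pi * ?t l / (2 * pi)) sums (Re (integral {0..2 * pi} ?g) / (2 * pi))"
    by (rule sums_divide)
  then have J: "bessel_J m x = Re (integral {0..2 * pi} ?g) / (2 * pi)"
    unfolding bessel_J_def by (simp add: sums_iff)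
  have "norm (integral {0..2 * pi} ?g) \<le> 1 * (2 * pi - 0)"
  proof (rule integral_bound)
    show "norm (?g \<theta>) \<le> 1" for \<theta>
      by (simp add: norm_mult exp_minus_inverse)
  qed (auto intro!: continuous_intros)
  then have "norm (integral {0..2 * pi} ?g) \<le> 2 * pi"
    by (simp only: mult_1 diff_0_right)
  then have "\<bar>Re (integral {0..2 * pi} ?g)\<bar> \<le> 2 * pi"
    by (rule order_trans[OF abs_Re_le_cmod])
  then show ?thesis
    unfolding J abs_divide by (subst divide_le_eq_1_pos) (use pi_gt_zero in auto)
qed

section \<open>Decay of the expansion coefficients\<close>

lemma abs_le_freq_norm: "\<bar>of_int (fst k)\<bar> \<le> freq_norm k" "\<bar>of_int (snd k)\<bar> \<le> freq_norm k"
  unfolding freq_norm_def by (auto intro: real_sqrt_ge_abs1 real_sqrt_ge_abs2)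

lemma finite_freq_norm_le: "finite {k. freq_norm k \<le> R}"
proof (rule finite_subset)
  have "max \<bar>fst k\<bar> \<bar>snd k\<bar> \<le> \<lceil>R\<rceil>" if "freq_norm k \<le> R" for k
  proof -
    have "of_int \<bar>fst k\<bar> \<le> R" "of_int \<bar>snd k\<bar> \<le> R"
      using abs_le_freq_norm[of k] that by auto
    then show ?thesis by linarith
  qed
  then show "{k. freq_norm k \<le> R} \<subseteq> freq_box (nat \<lceil>R\<rceil>)"
    unfolding freq_box_def by (smt (verit) int_nat_eq mem_Collect_eq subsetI)
qed simp

text \<open>Far from the zero, \<open>r\<^sup>2 - z\<^sup>2\<close> is comparable to the square of
  the frequency, so the bound 1 on the Bessel function gives quadratic decay. The finitely many
  remaining frequencies only enlarge the constant.\<close>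

lemma coef_bound:
  "\<exists>C\<ge>0. \<forall>k. norm (coef m n k) \<le> C \<and> norm (coef m n k) * freq_norm k \<le> C"
proof -
  define z where "z = bessel_zero m n"
  define c where "c = sqrt pi * \<bar>z\<bar> / 2"
  \<comment> \<open>Beyond this radius, the part 2|z| gives
    \<open>z\<^sup>2 \<le> s\<^sup>2 / 4\<close>, while the 1 gives \<open>s \<ge> 1\<close> and
    keeps \<open>r\<close> strictly above \<open>z\<close>.\<close>
  define R where "R = 2 * \<bar>z\<bar> + 1"
  have c0: "c \<ge> 0" by (simp add: c_def)
  have norm_coef: "norm (coef m n k) = c * \<bar>bessel_quot m n (pi * freq_norm k)\<bar>" for k
  proof -
    have "norm (exp (- (\<i> * of_int m * of_real (freq_angle k)))) = 1" by simp
    moreover have "\<bar>bessel_sign m\<bar> = 1"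
      by (simp add: bessel_sign_def power_int_abs)
    moreover have "norm (\<i> powi m) = 1" by (simp add: norm_power_int)
    ultimately show ?thesis
      by (simp add: coef_def norm_mult norm_divide abs_mult c_def z_def norm_power del: norm_exp_eq_Re)
  qed
  define F where "F = {k. freq_norm k \<le> R}"
  \<comment> \<open>The weight \<open>1 + freq_norm k\<close> delivers both required bounds
    together. The sum also takes care of a frequency at the removable singularity.\<close>
  define D where "D = (\<Sum>k\<in>F. norm (coef m n k) * (1 + freq_norm k))"
  have fn0: "freq_norm k \<ge> 0" for k by (simp add: freq_norm_def)
  have D0: "D \<ge> 0" unfolding D_def by (intro sum_nonneg mult_nonneg_nonneg) (auto simp: add_nonneg_nonneg fn0)
  have main: "norm (coef m n k) * (1 + freq_norm k) \<le> D + 4 * c" for k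
  proof (cases "k \<in> F")
    case True
    then have "norm (coef m n k) * (1 + freq_norm k) \<le> D"
      unfolding D_def using finite_freq_norm_le[of R] fn0
      by (intro member_le_sum) (auto simp: F_def add_nonneg_nonneg)
    then show ?thesis using c0 by simp
  next
    case False
    define s where "s = freq_norm k"
    define r where "r = pi * s"
    have s: "s > R" using False by (simp add: F_def s_def)
    have "1 * s \<le> pi * s" by (rule mult_right_mono) (use s pi_gt3 in \<open>auto simp: R_def\<close>)
    then have rs: "r \<ge> s" by (simp add: r_def)
    have s1: "s \<ge> 1" "2 * \<bar>z\<bar> \<le> s" using s by (auto simp: R_def)
    have "\<bar>z\<bar>\<^sup>2 \<le> (s / 2)\<^sup>2" by (rule power_mono) (use s1 in auto)
    then have "z\<^sup>2 \<le> s\<^sup>2 / 4" by (simp add: power_divide)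
    moreover have "s\<^sup>2 \<le> r\<^sup>2" by (rule power_mono) (use rs s1 in auto)
    ultimately have q: "r\<^sup>2 - z\<^sup>2 \<ge> s\<^sup>2 / 2" using zero_le_power2[of s] by linarith
    have "r \<noteq> z" using rs s by (auto simp: R_def)
    then have "\<bar>bessel_quot m n r\<bar> = \<bar>bessel_J m r\<bar> / \<bar>r\<^sup>2 - z\<^sup>2\<bar>"
      by (simp add: bessel_quot_def Let_def flip: z_def)
    also have "\<dots> \<le> 1 / (s\<^sup>2 / 2)"
    proof (intro frac_le abs_bessel_J_le_1)
      show "s\<^sup>2 / 2 \<le> \<bar>r\<^sup>2 - z\<^sup>2\<bar>" using q by linarith
    qed (use rs s1 in auto)
    finally have "norm (coef m n k) \<le> c * (2 / s\<^sup>2)"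
      unfolding norm_coef s_def[symmetric] r_def[symmetric] using c0 by (intro mult_left_mono) auto
    then have "norm (coef m n k) * (1 + s) \<le> c * (2 / s\<^sup>2) * (1 + s)"
      using s1 by (intro mult_right_mono) auto
    also have "\<dots> = c * (2 * (1 + s) / s\<^sup>2)" by simp
    also have "2 * (1 + s) / s\<^sup>2 \<le> 4"
    proof -
      have "s * 1 \<le> s * s" by (rule mult_left_mono) (use s1 in auto)
      then have "s \<le> s\<^sup>2" by (simp only: mult_1_right power2_eq_square)
      then have "2 * (1 + s) \<le> 4 * s\<^sup>2"
        using s1(1) by (smt (verit))
      then show ?thesis using s1 by (simp add: divide_le_eq)
    qed
    then have "c * (2 * (1 + s) / s\<^sup>2) \<le> c * 4" using c0 by (rule mult_left_mono)
    finally show ?thesis using D0 by (simp add: s_def)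
  qed
  have "norm (coef m n k) \<le> D + 4 * c" "norm (coef m n k) * freq_norm k \<le> D + 4 * c" for k
  proof -
    have "0 \<le> norm (coef m n k) * freq_norm k" by (intro mult_nonneg_nonneg norm_ge_zero fn0)
    then show "norm (coef m n k) \<le> D + 4 * c" "norm (coef m n k) * freq_norm k \<le> D + 4 * c"
      using main[of k] norm_ge_zero[of "coef m n k"] unfolding distrib_left mult_1_right
      by linarith+
  qed
  then show ?thesis using c0 D0 by (intro exI[of _ "D + 4 * c"]) auto
qed

section \<open>The discrete Fourier transform on a square of odd side\<close>

lemma freq_box_eq: "freq_box K = {- int K..int K} \<times> {- int K..int K}"
  by (auto simp: freq_box_def)

lemma freq_box_iff: "p \<in> freq_box K \<longleftrightarrow> \<bar>fst p\<bar> \<le> int K \<and> \<bar>snd p\<bar> \<le> int K"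
  by (simp add: freq_box_def)

lemma card_freq_box: "card (freq_box K) = (2 * K + 1)\<^sup>2"
proof -
  have "nat (int K - (- int K) + 1) = 2 * K + 1" by simp
  then show ?thesis by (simp add: freq_box_eq power2_eq_square card_cartesian_product)
qed

text \<open>Characters of the square of the cyclic group of order L = 2K + 1. The symmetric box will
  index both positions and frequencies, but \<open>p\<close> may be any integer pair, so that sums
  and differences of positions are allowed.\<close>

definition dft_char :: "nat \<Rightarrow> int \<times> int \<Rightarrow> int \<times> int \<Rightarrow> complex" where
  "dft_char K k p = cis (- (2 * pi * of_int (fst k * fst p + snd k * snd p) / real (2 * K + 1)))"

text \<open>The prefactor is the area of a grid cell, matching the normalisation of
  \<open>finite_fourier\<close>.\<close>

definition dft :: "nat \<Rightarrow> (int \<times> int \<Rightarrow> complex) \<Rightarrow> int \<times> int \<Rightarrow> complex" where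
  "dft K \<phi> k = of_real ((2 / real (2 * K + 1))\<^sup>2) * (\<Sum>p\<in>freq_box K. \<phi> p * dft_char K k p)"

section \<open>Characters, orthogonality, Parseval and discrete convolution\<close>

lemma norm_dft_char [simp]: "norm (dft_char K k p) = 1"
  by (simp add: dft_char_def)

lemma dft_char_add: "dft_char K k (p + q) = dft_char K k p * dft_char K k q"
  unfolding dft_char_def cis_mult
  by (rule arg_cong[where f = cis]) (simp add: distrib_left add_divide_distrib)

lemma dft_char_diff: "dft_char K k (p - q) = dft_char K k p * cnj (dft_char K k q)"
  unfolding dft_char_def cis_mult cis_cnj
  by (rule arg_cong[where f = cis]) (simp add: algebra_simps add_divide_distrib diff_divide_distrib)

lemma dft_diff: "dft K (\<lambda>p. \<phi> p - \<psi> p) k = dft K \<phi> k - dft K \<psi> k"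
  by (simp add: dft_def left_diff_distrib sum_subtractf right_diff_distrib)

text \<open>A geometric sum over one full period, whose ratio is an L-th root of unity different
  from 1.\<close>

lemma sum_cis_eq_0:
  assumes "\<not> int (2 * K + 1) dvd r"
  shows "(\<Sum>j\<in>{- int K..int K}. cis (- (2 * pi * of_int (j * r) / real (2 * K + 1)))) = 0"
proof -
  define L where "L = 2 * K + 1"
  define \<theta> where "\<theta> = - (2 * pi * of_int r / real L)"
  have L: "L > 0" by (simp add: L_def)
  have ne: "cis \<theta> \<noteq> 1"
  proof
    assume "cis \<theta> = 1"
    then have "cos \<theta> = 1" by (metis cis.simps(1) one_complex.simps(1))
    then obtain n :: int where "\<theta> = of_int n * 2 * pi"
      using cos_one_2pi_int by auto
    then have "pi * of_int r = pi * (- (of_int n * real L))"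
      using L by (simp add: \<theta>_def field_simps)
    then have "of_int r = - (of_int n * real L)"
      unfolding mult_cancel_left by simp
    then have "of_int r = (of_int (int L * (- n)) :: real)" by (simp add: mult.commute)
    then have "int L dvd r" unfolding of_int_eq_iff by simp
    with assms show False by (simp add: L_def)
  qed
  have "(cis \<theta>) ^ L = cis (2 * pi * of_int (- r))"
    using L by (simp add: Complex.DeMoivre \<theta>_def)
  also have "\<dots> = 1" by (rule cis_multiple_2pi) simp
  finally have root: "(cis \<theta>) ^ L = 1" .
  have "(\<Sum>j\<in>{- int K..int K}. cis (of_int j * \<theta>)) = (\<Sum>i<L. cis (- (real K * \<theta>)) * (cis \<theta>) ^ i)"
    by (rule sum.reindex_bij_witness[of _ "\<lambda>i. int i - int K" "\<lambda>j. nat (j + int K)"])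
      (auto simp: L_def Complex.DeMoivre cis_mult algebra_simps)
  also have "\<dots> = 0"
    by (simp add: geometric_sum[OF ne] root flip: sum_distrib_left)
  finally show ?thesis by (simp add: \<theta>_def L_def mult_ac)
qed

text \<open>The sum factors into two one-dimensional ones. The strict bounds, satisfied by
  differences of two points of the box, leave zero as the only multiple of L that a coordinate can
  equal.\<close>

lemma sum_dft_char:
  assumes "\<bar>fst r\<bar> < int (2 * K + 1)" "\<bar>snd r\<bar> < int (2 * K + 1)"
  shows "(\<Sum>k\<in>freq_box K. dft_char K k r) = (if r = 0 then of_nat ((2 * K + 1)\<^sup>2) else 0)"
proof (cases "r = 0")
  case True
  then show ?thesis using card_freq_box[of K] by (simp add: dft_char_def)
next
  case False
  let ?e = "\<lambda>j s. cis (- (2 * pi * of_int (j * s) / real (2 * K + 1)))"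
  have "(\<Sum>k\<in>freq_box K. dft_char K k r) =
      (\<Sum>k\<in>{- int K..int K} \<times> {- int K..int K}. ?e (fst k) (fst r) * ?e (snd k) (snd r))"
    unfolding freq_box_eq
  proof (rule sum.cong[OF refl])
    fix k
    show "dft_char K k r = ?e (fst k) (fst r) * ?e (snd k) (snd r)"
      unfolding dft_char_def cis_mult
      by (rule arg_cong[where f = cis]) (simp add: distrib_left add_divide_distrib)
  qed
  also have "\<dots> = (\<Sum>j\<in>{- int K..int K}. ?e j (fst r)) * (\<Sum>j\<in>{- int K..int K}. ?e j (snd r))"
    by (simp add: sum_product sum.cartesian_product case_prod_unfold)
  also have "\<dots> = 0"
  proof (cases "fst r = 0")
    case True
    then have "snd r \<noteq> 0" using False by (auto simp: prod_eq_iff)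
    then have "\<not> int (2 * K + 1) dvd snd r" using assms(2) zdvd_imp_le[of _ "\<bar>snd r\<bar>"] by fastforce
    from sum_cis_eq_0[OF this] show ?thesis by (simp only: mult_zero_right)
  next
    case False
    then have "\<not> int (2 * K + 1) dvd fst r" using assms(1) zdvd_imp_le[of _ "\<bar>fst r\<bar>"] by fastforce
    from sum_cis_eq_0[OF this] show ?thesis by (simp only: mult_zero_left)
  qed
  finally show ?thesis using False by simp
qed

text \<open>Expanding the squared modulus and summing over \<open>k\<close> first, orthogonality
  removes all off-diagonal pairs.\<close>

lemma dft_parseval:
  "(\<Sum>k\<in>freq_box K. (norm (\<Sum>p\<in>freq_box K. \<phi> p * dft_char K k p))\<^sup>2) =
    (real (2 * K + 1))\<^sup>2 * (\<Sum>p\<in>freq_box K. (norm (\<phi> p))\<^sup>2)"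
proof -
  let ?B = "freq_box K"
  have "complex_of_real (\<Sum>k\<in>?B. (norm (\<Sum>p\<in>?B. \<phi> p * dft_char K k p))\<^sup>2) =
      (\<Sum>k\<in>?B. (\<Sum>p\<in>?B. \<phi> p * dft_char K k p) * cnj (\<Sum>q\<in>?B. \<phi> q * dft_char K k q))"
    by (simp only: of_real_sum complex_norm_square)
  also have "\<dots> = (\<Sum>k\<in>?B. \<Sum>p\<in>?B. \<Sum>q\<in>?B. \<phi> p * cnj (\<phi> q) * dft_char K k (p - q))"
    by (simp add: sum_product dft_char_diff mult_ac)
  also have "\<dots> = (\<Sum>p\<in>?B. \<Sum>k\<in>?B. \<Sum>q\<in>?B. \<phi> p * cnj (\<phi> q) * dft_char K k (p - q))"
    by (rule sum.swap)
  also have "\<dots> = (\<Sum>p\<in>?B. \<Sum>q\<in>?B. \<Sum>k\<in>?B. \<phi> p * cnj (\<phi> q) * dft_char K k (p - q))"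
    by (intro sum.cong sum.swap refl)
  also have "\<dots> = (\<Sum>p\<in>?B. \<Sum>q\<in>?B. \<phi> p * cnj (\<phi> q) *
      (if p = q then of_nat ((2 * K + 1)\<^sup>2) else 0))"
  proof (intro sum.cong refl)
    fix p q assume "p \<in> ?B" "q \<in> ?B"
    then have "\<bar>fst (p - q)\<bar> < int (2 * K + 1)" "\<bar>snd (p - q)\<bar> < int (2 * K + 1)"
      by (auto simp: freq_box_iff)
    from sum_dft_char[OF this]
    show "(\<Sum>k\<in>?B. \<phi> p * cnj (\<phi> q) * dft_char K k (p - q)) =
        \<phi> p * cnj (\<phi> q) * (if p = q then of_nat ((2 * K + 1)\<^sup>2) else 0)"
      by (simp flip: sum_distrib_left)
  qed
  also have "\<dots> = (\<Sum>p\<in>?B. \<phi> p * cnj (\<phi> p) * of_nat ((2 * K + 1)\<^sup>2))"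
    by (intro sum.cong refl) (simp add: if_distrib cong: if_cong)
  also have "\<dots> = complex_of_real ((real (2 * K + 1))\<^sup>2 * (\<Sum>p\<in>?B. (norm (\<phi> p))\<^sup>2))"
    by (simp only: of_real_sum of_real_mult complex_norm_square)
      (simp add: sum_distrib_left sum_distrib_right mult_ac)
  finally show ?thesis by (simp only: of_real_eq_iff)
qed

text \<open>By Parseval, the cell area 4 / L^2 is balanced by one factor L from the identity and one
  from the L^2 points of the box. The constant 4, the area of the sampling square, is thus
  independent of \<open>K\<close>.\<close>

lemma L2_dft_le:
  assumes "\<And>p. p \<in> freq_box K \<Longrightarrow> norm (\<phi> p) \<le> M" and "M \<ge> 0"
  shows "L2_set (\<lambda>k. norm (dft K \<phi> k)) (freq_box K) \<le> 4 * M"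
proof -
  define L where "L = real (2 * K + 1)"
  have L: "L > 0" by (simp add: L_def)
  have "(\<Sum>p\<in>freq_box K. (norm (\<phi> p))\<^sup>2) \<le> (\<Sum>p\<in>freq_box K. M\<^sup>2)"
    by (intro sum_mono power_mono assms) auto
  also have "\<dots> = L\<^sup>2 * M\<^sup>2" by (simp add: card_freq_box L_def)
  finally have le: "(\<Sum>p\<in>freq_box K. (norm (\<phi> p))\<^sup>2) \<le> L\<^sup>2 * M\<^sup>2" .
  have "(\<Sum>k\<in>freq_box K. (norm (dft K \<phi> k))\<^sup>2) =
      ((2 / L)\<^sup>2)\<^sup>2 * (\<Sum>k\<in>freq_box K. (norm (\<Sum>p\<in>freq_box K. \<phi> p * dft_char K k p))\<^sup>2)"
    by (simp only: dft_def norm_mult power_mult_distrib norm_of_real abs_power2 L_def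
        flip: sum_distrib_left)
  also have "\<dots> = ((2 / L)\<^sup>2)\<^sup>2 * (L\<^sup>2 * (\<Sum>p\<in>freq_box K. (norm (\<phi> p))\<^sup>2))"
    unfolding dft_parseval L_def ..
  also have "\<dots> \<le> ((2 / L)\<^sup>2)\<^sup>2 * (L\<^sup>2 * (L\<^sup>2 * M\<^sup>2))"
    by (intro mult_left_mono le) auto
  also have "\<dots> = (4 * M)\<^sup>2" using L by (simp add: power2_eq_square)
  finally show ?thesis unfolding L2_set_def using assms(2) by (simp add: real_le_lsqrt)
qed

text \<open>The hypothesis excludes wrap-around: the truncated convolution loses no nonzero product,
  and the substitution \<open>p = q + r\<close> separates the sums.\<close>

lemma dft_convolution:
  assumes "\<And>q r. \<lbrakk>q \<in> freq_box K; a q \<noteq> 0; b r \<noteq> 0\<rbrakk> \<Longrightarrow> r \<in> freq_box K \<and> q + r \<in> freq_box K"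
  shows "(\<Sum>p\<in>freq_box K. (\<Sum>q\<in>freq_box K. a q * b (p - q)) * dft_char K k p) =
    (\<Sum>q\<in>freq_box K. a q * dft_char K k q) * (\<Sum>r\<in>freq_box K. b r * dft_char K k r)"
proof -
  have "(\<Sum>p\<in>freq_box K. (\<Sum>q\<in>freq_box K. a q * b (p - q)) * dft_char K k p) =
      (\<Sum>p\<in>freq_box K. \<Sum>q\<in>freq_box K. a q * b (p - q) * dft_char K k p)"
    by (simp add: sum_distrib_right)
  also have "\<dots> = (\<Sum>q\<in>freq_box K. \<Sum>p\<in>freq_box K. a q * b (p - q) * dft_char K k p)"
    by (rule sum.swap)
  also have "\<dots> = (\<Sum>q\<in>freq_box K. \<Sum>r\<in>freq_box K. a q * dft_char K k q * (b r * dft_char K k r))"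
  proof (rule sum.cong[OF refl])
    fix q assume q: "q \<in> freq_box K"
    have A: "r \<in> freq_box K" "q + r \<in> freq_box K" if "a q \<noteq> 0" "b r \<noteq> 0" for r
      using assms[OF q that] by auto
    \<comment> \<open>Shifting by \<open>q\<close> does not preserve the box, but it is a bijection
      between the nonzero terms: the hypothesis puts \<open>p - q\<close> in the box for
      \<open>p\<close> in \<open>?S\<close>, and \<open>q + r\<close> in the box for
      \<open>r\<close> in \<open>?T\<close>.\<close>
    let ?S = "{p \<in> freq_box K. a q * b (p - q) \<noteq> 0}" and ?T = "{r \<in> freq_box K. a q * b r \<noteq> 0}"
    have "(\<Sum>p\<in>freq_box K. a q * b (p - q) * dft_char K k p) =
        (\<Sum>p\<in>?S. a q * b (p - q) * dft_char K k p)"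
      by (rule sum.mono_neutral_right) auto
    also have "\<dots> = (\<Sum>r\<in>?T. a q * dft_char K k q * (b r * dft_char K k r))"
      by (rule sum.reindex_bij_witness[of _ "\<lambda>r. q + r" "\<lambda>p. p - q"])
        (auto intro: A simp: algebra_simps simp flip: dft_char_add)
    also have "\<dots> = (\<Sum>r\<in>freq_box K. a q * dft_char K k q * (b r * dft_char K k r))"
      by (rule sum.mono_neutral_left) auto
    finally show "(\<Sum>p\<in>freq_box K. a q * b (p - q) * dft_char K k p) =
        (\<Sum>r\<in>freq_box K. a q * dft_char K k q * (b r * dft_char K k r))" .
  qed
  also have "\<dots> = (\<Sum>q\<in>freq_box K. a q * dft_char K k q) * (\<Sum>r\<in>freq_box K. b r * dft_char K k r)"
    by (simp add: sum_product)
  finally show ?thesis .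
qed

section \<open>From grid sums to the discrete transform: the half-cell phase\<close>

definition lattice_pt :: "real \<Rightarrow> int \<times> int \<Rightarrow> real \<times> real" where
  "lattice_pt \<delta> p = (\<delta> * of_int (fst p), \<delta> * of_int (snd p))"

text \<open>The phase \<omega>(k): the exponential of the finite Fourier transform evaluated at the
  offset \<open>(- \<delta> / 2, - \<delta> / 2)\<close>.\<close>

definition half_phase :: "nat \<Rightarrow> int \<times> int \<Rightarrow> complex" where
  "half_phase K k = cis (pi * of_int (fst k + snd k) / real (2 * K + 1))"

text \<open>
  With an odd number of points per side, the grid is \<open>\<delta> (\<int> - 1/2)\<close> in each coordinate, so that the
  sum of two grid points is not a grid point: this is the origin of the phase.
\<close>

lemma finite_fourier_eq_dft:
  fixes K :: nat
  defines "\<delta> \<equiv> 2 / real (2 * K + 1)"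
  shows "finite_fourier f k (2 * K + 1) =
    half_phase K k * dft K (\<lambda>p. f (lattice_pt \<delta> p - (\<delta> / 2, \<delta> / 2))) k"
proof -
  define L where "L = 2 * K + 1"
  have L: "real L > 0" by (simp add: L_def)
  have \<delta>: "\<delta> = 2 / real L" by (simp add: \<delta>_def L_def)
  let ?x = "\<lambda>p. lattice_pt \<delta> p - (\<delta> / 2, \<delta> / 2)"
  let ?F = "\<lambda>y. f y * exp (- (of_real pi * \<i> *
          of_real (of_int (fst k) * fst y + of_int (snd k) * snd y)))"
  have "(\<Sum>i=1..L. \<Sum>j=1..L. ?F (grid_pt L i, grid_pt L j)) =
      (\<Sum>p\<in>{1..L} \<times> {1..L}. ?F (grid_pt L (fst p), grid_pt L (snd p)))"
    by (simp add: sum.cartesian_product case_prod_unfold)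
  also have "\<dots> = (\<Sum>p\<in>freq_box K. ?F (?x p))"
  proof (rule sum.reindex_bij_witness[of _ "\<lambda>p. (nat (fst p + int K + 1), nat (snd p + int K + 1))"
        "\<lambda>i. (int (fst i) - int K - 1, int (snd i) - int K - 1)"])
    fix i assume "i \<in> {1..L} \<times> {1..L}"
    \<comment> \<open>Since L is odd, the left end -1 equals
      \<open>- \<delta> * K - \<delta> / 2\<close>, so the index \<open>j\<close> in 1..L
      corresponds to the centred index \<open>j - K - 1\<close>.\<close>
    have "\<delta> * real K = 1 - \<delta> / 2"
      by (simp add: \<delta>_def field_simps)
    then have "grid_pt L j = \<delta> * of_int (int j - int K - 1) - \<delta> / 2" for j
      by (simp add: grid_pt_def right_diff_distrib left_diff_distrib flip: \<delta>)
    then show "?F (?x (int (fst i) - int K - 1, int (snd i) - int K - 1)) =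
        ?F (grid_pt L (fst i), grid_pt L (snd i))"
      by (simp add: lattice_pt_def)
  qed (auto simp: freq_box_iff L_def)
  also have "\<dots> = (\<Sum>p\<in>freq_box K. half_phase K k * (f (?x p) * dft_char K k p))"
  proof (rule sum.cong[OF refl])
    fix p
    have "exp (- (of_real pi * \<i> *
          of_real (of_int (fst k) * fst (?x p) + of_int (snd k) * snd (?x p)))) =
        cis (- (pi * (of_int (fst k) * fst (?x p) + of_int (snd k) * snd (?x p))))"
      by (simp add: cis_conv_exp mult_ac)
    also have "- (pi * (of_int (fst k) * fst (?x p) + of_int (snd k) * snd (?x p))) =
        pi * of_int (fst k + snd k) / real L +
        - (2 * pi * of_int (fst k * fst p + snd k * snd p) / real L)"
      using L by (simp add: lattice_pt_def \<delta> field_simps)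
    also have "cis \<dots> = half_phase K k * dft_char K k p"
      by (simp only: half_phase_def dft_char_def cis_mult L_def)
    finally show "?F (?x p) = half_phase K k * (f (?x p) * dft_char K k p)"
      by (simp only: mult_ac)
  qed
  finally have *: "(\<Sum>i=1..L. \<Sum>j=1..L. ?F (grid_pt L i, grid_pt L j)) =
      half_phase K k * (\<Sum>p\<in>freq_box K. f (?x p) * dft_char K k p)"
    by (simp only: sum_distrib_left)
  have "finite_fourier f k L = of_real ((2 / real L)\<^sup>2) * (\<Sum>i=1..L. \<Sum>j=1..L. ?F (grid_pt L i, grid_pt L j))"
    by (simp only: finite_fourier_def fst_conv snd_conv)
  then show ?thesis
    unfolding * dft_def by (simp only: L_def mult_ac)
qed

lemma norm_half_phase [simp]: "norm (half_phase K k) = 1"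
  by (simp add: half_phase_def)

text \<open>A chord is no longer than its arc; its length is 2 |sin(x/2)|.\<close>

lemma norm_cis_minus_1_le: "norm (cis x - 1) \<le> \<bar>x\<bar>"
proof -
  have "(norm (cis x - 1))\<^sup>2 = (cos x - 1)\<^sup>2 + (sin x)\<^sup>2"
    by (simp add: cmod_power2)
  also have "\<dots> = 2 - 2 * cos x"
    using sin_cos_squared_add[of x] by (simp add: power2_eq_square algebra_simps)
  also have "\<dots> = (2 * sin (x / 2))\<^sup>2"
    using cos_double_sin[of "x / 2"] by (simp add: power_mult_distrib)
  also have "\<dots> \<le> \<bar>x\<bar>\<^sup>2"
    using abs_sin_x_le_abs_x[of "x / 2"] by (intro power2_le_iff_abs_le[THEN iffD2]) auto
  finally show ?thesis by (rule power2_le_imp_le) simp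
qed

text \<open>Each coordinate of \<open>k\<close> costs at most \<open>freq_norm k\<close>, hence the
  factor 2. This linear growth in \<open>k\<close> is what the second bound of
  \<open>coef_bound\<close> absorbs.\<close>

lemma norm_half_phase_minus_1_le:
  "norm (half_phase K k - 1) \<le> 2 * pi * freq_norm k / real (2 * K + 1)"
proof -
  have "\<bar>of_int (fst k + snd k)\<bar> \<le> 2 * freq_norm k"
    using abs_le_freq_norm[of k] by simp
  then have "pi * \<bar>of_int (fst k + snd k)\<bar> / real (2 * K + 1) \<le> pi * (2 * freq_norm k) / real (2 * K + 1)"
    by (intro divide_right_mono mult_left_mono) auto
  moreover have "norm (half_phase K k - 1) \<le> \<bar>pi * of_int (fst k + snd k) / real (2 * K + 1)\<bar>"
    unfolding half_phase_def by (rule norm_cis_minus_1_le)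
  ultimately show ?thesis by (simp add: abs_mult mult_ac)
qed

section \<open>Continuously differentiable functions supported in the disk\<close>

lemma zero_outside_compact_bounded:
  fixes f :: "'a::topological_space \<Rightarrow> 'b::real_normed_vector"
  assumes "continuous_on UNIV f" "compact S" "\<And>x. x \<notin> S \<Longrightarrow> f x = 0"
  shows "\<exists>M\<ge>0. \<forall>x. norm (f x) \<le> M"
proof -
  have "compact (f ` S)"
    by (rule compact_continuous_image[OF continuous_on_subset[OF assms(1) subset_UNIV] assms(2)])
  then have "bounded (f ` S)" by (rule compact_imp_bounded)
  then obtain M where M: "\<And>x. x \<in> S \<Longrightarrow> norm (f x) \<le> M" by (auto simp: bounded_iff)
  have "norm (f x) \<le> max M 0" for x
  proof (cases "x \<in> S")
    case True
    then show ?thesis using M[of x] by simp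
  next
    case False
    then show ?thesis using assms(3)[of x] by simp
  qed
  then show ?thesis by (intro exI[of _ "max M 0"]) simp
qed

lemma has_vector_derivative_lipschitz:
  fixes h :: "real \<Rightarrow> 'a::real_normed_vector"
  assumes "\<And>x. (h has_vector_derivative h' x) (at x)" and "\<And>x. norm (h' x) \<le> M"
  shows "norm (h x - h y) \<le> M * \<bar>x - y\<bar>"
proof -
  have "norm (h x - h y) \<le> M * norm (x - y)"
  proof (rule differentiable_bound)
    show "(h has_derivative (\<lambda>u. u *\<^sub>R h' t)) (at t within UNIV)" for t
      using assms(1) by (simp add: has_vector_derivative_def)
    show "onorm (\<lambda>u. u *\<^sub>R h' t) \<le> M" for t
    proof (rule onorm_le)
      show "norm (u *\<^sub>R h' t) \<le> M * norm u" for u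
        using mult_right_mono[OF assms(2)[of t] norm_ge_zero[of u]] by (simp add: mult.commute)
    qed
  qed auto
  then show ?thesis by simp
qed

lemma has_vector_derivative_zero_outside:
  assumes "(h has_vector_derivative D) (at x)" "open U" "x \<in> U" "\<And>t. t \<in> U \<Longrightarrow> h t = 0"
  shows "D = 0"
proof -
  have "((\<lambda>_. 0) has_vector_derivative D) (at x)"
    by (rule has_vector_derivative_transform_within_open[OF assms(1-3)]) (use assms(4) in auto)
  then show ?thesis
    by (rule vector_derivative_unique_at[OF _ has_vector_derivative_const])
qed

text \<open>Off \<open>S\<close>, whose complement is open, the partial derivatives vanish along
  with \<open>f\<close>; being continuous, they are bounded. The mean value inequality along two
  axis-parallel segments then gives a Lipschitz bound in the l1 distance.\<close>

lemma C1_plane_lipschitz: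
  assumes "C1_plane f" "compact S" "supp f \<subseteq> S"
  shows "\<exists>M\<ge>0. (\<forall>x. norm (f x) \<le> M) \<and>
    (\<forall>x y. norm (f x - f y) \<le> M * (\<bar>fst x - fst y\<bar> + \<bar>snd x - snd y\<bar>))"
proof -
  have zero: "f x = 0" if "x \<notin> S" for x
    using that assms(3) by (auto simp: supp_def)
  obtain f1 f2 where f: "continuous_on UNIV f" "continuous_on UNIV f1" "continuous_on UNIV f2"
    and d1: "\<And>x y. ((\<lambda>t. f (t, y)) has_vector_derivative f1 (x, y)) (at x)"
    and d2: "\<And>x y. ((\<lambda>t. f (x, t)) has_vector_derivative f2 (x, y)) (at y)"
    using assms(1) unfolding C1_plane_def by blast
  have cl: "closed S" using assms(2) by (rule compact_imp_closed)
  have z1: "f1 z = 0" if z: "z \<notin> S" for z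
  proof -
    have "open ((\<lambda>t. (t, snd z)) -` (- S))"
      using cl by (intro open_vimage) (auto intro!: continuous_intros)
    from has_vector_derivative_zero_outside[OF d1[of "snd z" "fst z"] this] zero z
    have "f1 (fst z, snd z) = 0" by simp
    then show ?thesis by simp
  qed
  have z2: "f2 z = 0" if z: "z \<notin> S" for z
  proof -
    have "open ((\<lambda>t. (fst z, t)) -` (- S))"
      using cl by (intro open_vimage) (auto intro!: continuous_intros)
    from has_vector_derivative_zero_outside[OF d2[of "fst z" "snd z"] this] zero z
    have "f2 (fst z, snd z) = 0" by simp
    then show ?thesis by simp
  qed
  obtain M0 where M0: "M0 \<ge> 0" "\<And>x. norm (f x) \<le> M0"
    using zero_outside_compact_bounded[OF f(1) assms(2) zero] by blast
  obtain M1 where M1: "M1 \<ge> 0" "\<And>x. norm (f1 x) \<le> M1"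
    using zero_outside_compact_bounded[OF f(2) assms(2) z1] by blast
  obtain M2 where M2: "M2 \<ge> 0" "\<And>x. norm (f2 x) \<le> M2"
    using zero_outside_compact_bounded[OF f(3) assms(2) z2] by blast
  have lip: "norm (f x - f y) \<le> (M0 + M1 + M2) * (\<bar>fst x - fst y\<bar> + \<bar>snd x - snd y\<bar>)" for x y
  proof -
    have "norm (f x - f y) \<le> norm (f (fst x, snd x) - f (fst y, snd x)) + norm (f (fst y, snd x) - f (fst y, snd y))"
      using norm_triangle_ineq[of "f (fst x, snd x) - f (fst y, snd x)" "f (fst y, snd x) - f (fst y, snd y)"]
      by simp
    also have "\<dots> \<le> M1 * \<bar>fst x - fst y\<bar> + M2 * \<bar>snd x - snd y\<bar>"
      by (intro add_mono has_vector_derivative_lipschitz[OF d1] has_vector_derivative_lipschitz[OF d2] M1 M2)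
    also have "\<dots> \<le> (M0 + M1 + M2) * \<bar>fst x - fst y\<bar> + (M0 + M1 + M2) * \<bar>snd x - snd y\<bar>"
      using M0(1) M1(1) M2(1) by (intro add_mono mult_right_mono) auto
    finally show ?thesis by (simp add: distrib_left)
  qed
  have "norm (f x) \<le> M0 + M1 + M2" for x
    using M0(2)[of x] M1(1) M2(1) by linarith
  with lip show ?thesis
    using M0(1) M1(1) M2(1) by (intro exI[of _ "M0 + M1 + M2"] conjI allI) auto
qed

text \<open>
  By continuity \<open>f\<close> also vanishes on the bounding circle. The strict inequality prevents the sum of
  two points of the supports from reaching the grid line that is missing at \<open>1\<close>.
\<close>

lemma supp_cball_strict:
  fixes f :: "real \<times> real \<Rightarrow> complex"
  assumes "continuous_on UNIV f" "supp f \<subseteq> cball 0 r" "f x \<noteq> 0"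
  shows "\<bar>fst x\<bar> < r" "\<bar>snd x\<bar> < r"
proof -
  have "supp f = f -` (- {0})" by (auto simp: supp_def)
  then have "open (supp f)" using assms(1) open_vimage[of "- {0}" f] by auto
  \<comment> \<open>Without closure, the support of a continuous function is open, so containment in
    the closed ball already means containment in its interior.\<close>
  then have "supp f \<subseteq> interior (cball 0 r)" using assms(2) by (rule interior_maximal[rotated])
  then have "x \<in> ball 0 r" using assms(3) by (auto simp: supp_def)
  then have "norm x < r" by simp
  then show "\<bar>fst x\<bar> < r" "\<bar>snd x\<bar> < r"
    using norm_fst_le[of "fst x" "snd x"] norm_snd_le[of "snd x" "fst x"] by simp_all
qed

lemma integrable_zero_outside_compact:
  fixes F :: "'a::euclidean_space \<Rightarrow> complex"
  assumes "continuous_on UNIV F" "compact S" "\<And>x. x \<notin> S \<Longrightarrow> F x = 0"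
  shows "integrable lborel F"
proof -
  have "integrable lborel (\<lambda>x. indicator S x *\<^sub>R F x)"
    using assms by (intro borel_integrable_compact) (auto intro: continuous_on_subset)
  moreover have "(\<lambda>x. indicator S x *\<^sub>R F x) = F"
    using assms(3) by (auto simp: indicator_def)
  ultimately show ?thesis by simp
qed

section \<open>Splitting the convolution integral into grid cells\<close>

text \<open>Half-open, so that for positive \<open>\<delta>\<close> the lattice translates tile the
  plane without overlap.\<close>

definition cell :: "real \<Rightarrow> (real \<times> real) set" where
  "cell \<delta> = {0..<\<delta>} \<times> {0..<\<delta>}"

lemma sets_cell [measurable]: "cell \<delta> \<in> sets borel"
  unfolding cell_def by (intro borel_Times) auto

lemma integral_cell: "\<delta> \<ge> 0 \<Longrightarrow> integral\<^sup>L lborel (\<lambda>t. indicator (cell \<delta>) t :: real) = \<delta>\<^sup>2"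
  and integrable_cell: "integrable lborel (\<lambda>t. indicator (cell \<delta>) t :: real)"
proof -
  have "emeasure lborel (cell \<delta>) = emeasure lborel {0..<\<delta>} * emeasure lborel {0..<\<delta>}"
    unfolding cell_def lborel_prod[symmetric] by (intro lborel.emeasure_pair_measure_Times) auto
  also have "\<dots> = ennreal ((max \<delta> 0)\<^sup>2)"
    by (cases "\<delta> \<ge> 0") (simp_all add: power2_eq_square ennreal_mult max_def)
  finally have e: "emeasure lborel (cell \<delta>) = ennreal ((max \<delta> 0)\<^sup>2)" .
  then have "measure lborel (cell \<delta>) = (max \<delta> 0)\<^sup>2" by (simp add: measure_def)
  then show "\<delta> \<ge> 0 \<Longrightarrow> integral\<^sup>L lborel (\<lambda>t. indicator (cell \<delta>) t :: real) = \<delta>\<^sup>2" by (simp add: max_def)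
  show "integrable lborel (\<lambda>t. indicator (cell \<delta>) t :: real)" using e by (simp add: integrable_indicator_iff)
qed

lemma integral_translate:
  fixes F :: "'a::euclidean_space \<Rightarrow> 'b::{banach, second_countable_topology}"
  assumes "F \<in> borel_measurable borel"
  shows "integral\<^sup>L lborel F = integral\<^sup>L lborel (\<lambda>t. F (c + t))"
proof -
  have "integral\<^sup>L (distr lborel borel ((+) c)) F = integral\<^sup>L lborel (\<lambda>t. F (c + t))"
    using assms by (intro integral_distr) auto
  then show ?thesis by (simp add: lborel_distr_plus)
qed

text \<open>The tiling of the line by half-open intervals: the floor names the only tile containing
  \<open>y\<close>.\<close>

lemma floor_divide_unique:
  fixes \<delta> y :: real
  assumes "\<delta> > 0"
  shows "y - \<delta> * of_int q \<in> {0..<\<delta>} \<longleftrightarrow> q = \<lfloor>y / \<delta>\<rfloor>"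
proof -
  have "q = \<lfloor>y / \<delta>\<rfloor> \<longleftrightarrow> of_int q \<le> y / \<delta> \<and> y / \<delta> < of_int q + 1"
    using floor_eq_iff[of "y / \<delta>" q] by auto
  then show ?thesis using assms by (auto simp: field_simps)
qed

text \<open>Every point lies in exactly one lattice translate of the cell, and those translates that
  meet the support of \<open>F\<close> have their index in the box. Translation invariance moves
  each piece back to the cell at the origin.\<close>

lemma integral_eq_sum_cells:
  fixes F :: "real \<times> real \<Rightarrow> complex" and K :: nat
  defines "\<delta> \<equiv> 2 / real (2 * K + 1)"
  assumes int: "integrable lborel F" and K: "K \<ge> 3"
    and zero: "\<And>x. F x \<noteq> 0 \<Longrightarrow> \<bar>fst x\<bar> < 1 / 2 \<and> \<bar>snd x\<bar> < 1 / 2"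
  shows "integral\<^sup>L lborel F =
    (\<Sum>q\<in>freq_box K. integral\<^sup>L lborel (\<lambda>t. indicator (cell \<delta>) t *\<^sub>R F (lattice_pt \<delta> q + t)))"
proof -
  have \<delta>: "\<delta> > 0" by (simp add: \<delta>_def)
  have meas [measurable]: "F \<in> borel_measurable borel" using int by simp
  have in_cell: "y - lattice_pt \<delta> q \<in> cell \<delta> \<longleftrightarrow> q = (\<lfloor>fst y / \<delta>\<rfloor>, \<lfloor>snd y / \<delta>\<rfloor>)" for y q
    using floor_divide_unique[OF \<delta>, of "fst y" "fst q"] floor_divide_unique[OF \<delta>, of "snd y" "snd q"]
    by (cases y; cases q) (auto simp: cell_def lattice_pt_def)
  have small: "\<bar>\<lfloor>s / \<delta>\<rfloor>\<bar> \<le> int K" if "\<bar>s\<bar> < 1 / 2" for s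
  proof -
    have "\<bar>s / \<delta>\<bar> = \<bar>s\<bar> * (real (2 * K + 1) / 2)" by (simp add: \<delta>_def abs_mult)
    also have "\<dots> \<le> 1 / 2 * (real (2 * K + 1) / 2)"
      using that by (intro mult_right_mono) auto
    \<comment> \<open>The bound (2K + 1) / 4 <= K - 1 is where \<open>K \<ge> 3\<close> enters; the
      spare 1 pays for rounding down negative numbers.\<close>
    also have "\<dots> \<le> real K - 1" using K by simp
    finally show ?thesis by linarith
  qed
  have pointwise: "F y = (\<Sum>q\<in>freq_box K. indicator (cell \<delta>) (y - lattice_pt \<delta> q) *\<^sub>R F y)" for y
  proof (cases "F y = 0")
    case False
    define q0 where "q0 = (\<lfloor>fst y / \<delta>\<rfloor>, \<lfloor>snd y / \<delta>\<rfloor>)"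
    have "q0 \<in> freq_box K" using small zero[OF False] by (simp add: q0_def freq_box_iff)
    moreover have "indicator (cell \<delta>) (y - lattice_pt \<delta> q) *\<^sub>R F y = (if q = q0 then F y else 0)" for q
      by (simp add: indicator_def in_cell q0_def)
    ultimately show ?thesis by simp
  qed simp
  have meas_cell [measurable]: "(\<lambda>y. indicator (cell \<delta>) (y - c) :: real) \<in> borel_measurable borel" for c
    by (rule measurable_compose[OF _ borel_measurable_indicator[OF sets_cell]]) simp
  have meas_q: "(\<lambda>y. indicator (cell \<delta>) (y - lattice_pt \<delta> q) *\<^sub>R F y) \<in> borel_measurable borel" for q
    by (intro borel_measurable_scaleR meas meas_cell)
  have intq: "integrable lborel (\<lambda>y. indicator (cell \<delta>) (y - lattice_pt \<delta> q) *\<^sub>R F y)" for q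
  proof (rule Bochner_Integration.integrable_bound[OF int])
    show "(\<lambda>y. indicator (cell \<delta>) (y - lattice_pt \<delta> q) *\<^sub>R F y) \<in> borel_measurable lborel"
      using meas_q by simp
  qed (auto simp: indicator_def)
  have "integral\<^sup>L lborel F =
      integral\<^sup>L lborel (\<lambda>y. \<Sum>q\<in>freq_box K. indicator (cell \<delta>) (y - lattice_pt \<delta> q) *\<^sub>R F y)"
    using pointwise by (intro Bochner_Integration.integral_cong refl)
  also have "\<dots> = (\<Sum>q\<in>freq_box K. integral\<^sup>L lborel (\<lambda>y. indicator (cell \<delta>) (y - lattice_pt \<delta> q) *\<^sub>R F y))"
    using intq by (rule Bochner_Integration.integral_sum)
  also have "\<dots> = (\<Sum>q\<in>freq_box K. integral\<^sup>L lborel (\<lambda>t. indicator (cell \<delta>) t *\<^sub>R F (lattice_pt \<delta> q + t)))"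
  proof (rule sum.cong[OF refl])
    fix q
    show "integral\<^sup>L lborel (\<lambda>y. indicator (cell \<delta>) (y - lattice_pt \<delta> q) *\<^sub>R F y) =
        integral\<^sup>L lborel (\<lambda>t. indicator (cell \<delta>) t *\<^sub>R F (lattice_pt \<delta> q + t))"
      unfolding integral_translate[OF meas_q, where c = "lattice_pt \<delta> q"] by simp
  qed
  finally show ?thesis .
qed

text \<open>Substituting \<open>y = lattice_pt \<delta> q + t\<close> in the convolution integral at
  a grid point leaves, for each fixed \<open>t\<close>, a discrete convolution in \<open>q\<close>,
  which the transform turns into a product. The offset \<open>h\<close> stays with \<open>g\<close>.
  Two transforms carry \<open>\<delta>\<^sup>2\<close> each, so division by one
  \<open>\<delta>\<^sup>2\<close>, the cell area, produces an average over the cell.\<close>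

lemma dft_convolution_samples:
  fixes f g :: "real \<times> real \<Rightarrow> complex" and K :: nat
  defines "\<delta> \<equiv> 2 / real (2 * K + 1)"
  assumes f: "continuous_on UNIV f" "supp f \<subseteq> cball 0 (1 / 2)"
    and g: "continuous_on UNIV g" "supp g \<subseteq> cball 0 (1 / 2)" and K: "K \<ge> 3"
  defines "h \<equiv> (\<delta> / 2, \<delta> / 2)"
  defines "u \<equiv> \<lambda>k t. dft K (\<lambda>q. f (lattice_pt \<delta> q + t)) k * dft K (\<lambda>r. g (lattice_pt \<delta> r - h - t)) k"
  shows "integrable lborel (\<lambda>t. indicator (cell \<delta>) t *\<^sub>R u k t)"
    and "dft K (\<lambda>p. convolution f g (lattice_pt \<delta> p - h)) k =
      integral\<^sup>L lborel (\<lambda>t. indicator (cell \<delta>) t *\<^sub>R u k t) / of_real (\<delta>\<^sup>2)"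
proof -
  have \<delta>: "\<delta> > 0" by (simp add: \<delta>_def)
  define a where "a = (\<lambda>t q. f (lattice_pt \<delta> q + t))"
  define b where "b = (\<lambda>t r. g (lattice_pt \<delta> r - h - t))"
  have f0: "f x = 0" if "x \<notin> cball 0 (1 / 2)" for x using f(2) that by (auto simp: supp_def)
  have cont: "continuous_on UNIV (\<lambda>t. a t q * b t r)" for q r
    unfolding a_def b_def
    by (intro continuous_intros continuous_on_compose2[OF f(1)] continuous_on_compose2[OF g(1)]) auto
  have int: "integrable lborel (\<lambda>t. a t q * b t r)" for q r
  proof (rule integrable_zero_outside_compact[OF cont])
    show "a t q * b t r = 0" if "t \<notin> cball (- lattice_pt \<delta> q) (1 / 2)" for t
      using that f0[of "lattice_pt \<delta> q + t"] by (simp add: a_def dist_norm norm_minus_commute)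
  qed simp
  have int_cell: "integrable lborel (\<lambda>t. indicator (cell \<delta>) t *\<^sub>R (a t q * b t r))" for q r
    by (rule integrable_mult_indicator[OF _ int]) simp
  have conv: "convolution f g (lattice_pt \<delta> p - h) =
      (\<Sum>q\<in>freq_box K. integral\<^sup>L lborel (\<lambda>t. indicator (cell \<delta>) t *\<^sub>R (a t q * b t (p - q))))" for p
  proof -
    let ?F = "\<lambda>y. f y * g (lattice_pt \<delta> p - h - y)"
    have "integrable lborel ?F"
    proof (rule integrable_zero_outside_compact[where S = "cball 0 (1 / 2)"])
      show "continuous_on UNIV ?F"
        by (intro continuous_intros continuous_on_compose2[OF f(1)] continuous_on_compose2[OF g(1)]) auto
    qed (use f0 in auto)
    then have "integral\<^sup>L lborel ?F =
        (\<Sum>q\<in>freq_box K. integral\<^sup>L lborel (\<lambda>t. indicator (cell \<delta>) t *\<^sub>R ?F (lattice_pt \<delta> q + t)))"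
      unfolding \<delta>_def
      by (rule integral_eq_sum_cells[OF _ K]) (use supp_cball_strict[OF f] in auto)
    moreover have "lattice_pt \<delta> p - h - (lattice_pt \<delta> q + t) = lattice_pt \<delta> (p - q) - h - t" for q t
      by (simp add: lattice_pt_def right_diff_distrib prod_eq_iff)
    ultimately show ?thesis
      unfolding convolution_def a_def b_def by simp
  qed
  have prod: "(\<Sum>p\<in>freq_box K. (\<Sum>q\<in>freq_box K. a t q * b t (p - q)) * dft_char K k p) =
      u k t / of_real (\<delta>\<^sup>2 * \<delta>\<^sup>2)" if t: "t \<in> cell \<delta>" for t
  proof -
    have "r \<in> freq_box K \<and> q + r \<in> freq_box K" if "a t q \<noteq> 0" "b t r \<noteq> 0" for q r
    proof -
      define L where "L = real (2 * K + 1)"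
      have L: "L > 0" "\<delta> = 2 / L" by (auto simp: L_def \<delta>_def)
      \<comment> \<open>One coordinate at a time: \<open>i\<close>, \<open>j\<close>,
        \<open>s\<close> stand for coordinates of \<open>q\<close>, \<open>r\<close>,
        \<open>t\<close>. Adding the two support bounds cancels \<open>s\<close> and gives |i + j -
        1/2| < K + 1/2; strictness is what excludes i + j = K + 1.\<close>
      have bd: "\<bar>j\<bar> \<le> int K \<and> \<bar>i + j\<bar> \<le> int K"
        if "\<bar>\<delta> * of_int i + s\<bar> < 1 / 2" "\<bar>\<delta> * of_int j - \<delta> / 2 - s\<bar> < 1 / 2" "0 \<le> s" "s < \<delta>" for i j s
      proof -
        have "\<bar>\<delta> * of_int j\<bar> < 1 / 2 + 3 * \<delta> / 2" using that by linarith
        then have "\<bar>of_int j\<bar> < L / 4 + 3 / 2"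
          using L by (simp add: abs_mult field_simps)
        moreover have "L / 4 + 3 / 2 \<le> real K + 1" using K by (simp add: L_def field_simps)
        ultimately have "\<bar>of_int j\<bar> < real K + 1" by linarith
        moreover have "\<bar>\<delta> * of_int (i + j) - \<delta> / 2\<bar> < 1"
          using that(1,2) unfolding abs_less_iff of_int_add distrib_left by linarith
        then have "\<bar>\<delta> * (of_int (i + j) - 1 / 2)\<bar> < 1" by (simp add: right_diff_distrib)
        then have "\<bar>of_int (i + j) - 1 / 2\<bar> < L / 2"
          using L by (simp add: abs_mult field_simps)
        then have "\<bar>of_int (i + j) - 1 / 2\<bar> < real K + 1 / 2" by (simp add: L_def)
        ultimately show ?thesis by linarith
      qed
      have s: "0 \<le> fst t" "fst t < \<delta>" "0 \<le> snd t" "snd t < \<delta>"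
        using t by (auto simp: cell_def)
      have A: "\<bar>\<delta> * of_int (fst q) + fst t\<bar> < 1 / 2" "\<bar>\<delta> * of_int (snd q) + snd t\<bar> < 1 / 2"
        using supp_cball_strict[OF f, of "lattice_pt \<delta> q + t"] that(1) by (auto simp: a_def lattice_pt_def)
      have B: "\<bar>\<delta> * of_int (fst r) - \<delta> / 2 - fst t\<bar> < 1 / 2" "\<bar>\<delta> * of_int (snd r) - \<delta> / 2 - snd t\<bar> < 1 / 2"
        using supp_cball_strict[OF g, of "lattice_pt \<delta> r - h - t"] that(2) by (auto simp: b_def h_def lattice_pt_def)
      show ?thesis
        using bd[OF A(1) B(1) s(1,2)] bd[OF A(2) B(2) s(3,4)] by (simp add: freq_box_iff)
    qed
    then have "(\<Sum>p\<in>freq_box K. (\<Sum>q\<in>freq_box K. a t q * b t (p - q)) * dft_char K k p) =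
        (\<Sum>q\<in>freq_box K. a t q * dft_char K k q) * (\<Sum>r\<in>freq_box K. b t r * dft_char K k r)"
      by (intro dft_convolution) auto
    moreover have "u k t = of_real (\<delta>\<^sup>2) * (\<Sum>q\<in>freq_box K. a t q * dft_char K k q) *
        (of_real (\<delta>\<^sup>2) * (\<Sum>r\<in>freq_box K. b t r * dft_char K k r))"
      by (simp only: u_def dft_def a_def b_def \<delta>_def)
    ultimately show ?thesis using \<delta> by (simp add: power2_eq_square)
  qed
  \<comment> \<open>With the indicator moved into the finite double sum, every summand is integrable
    by itself, so sums and integral may be exchanged.\<close>
  define v where "v = (\<lambda>t. \<Sum>p\<in>freq_box K. \<Sum>q\<in>freq_box K.
      (indicator (cell \<delta>) t *\<^sub>R (a t q * b t (p - q))) * dft_char K k p)"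
  have u_eq: "indicator (cell \<delta>) t *\<^sub>R u k t = of_real (\<delta>\<^sup>2 * \<delta>\<^sup>2) * v t" for t
  proof (cases "t \<in> cell \<delta>")
    case True
    then show ?thesis using prod[OF True] \<delta> by (simp add: v_def sum_distrib_right)
  qed (simp add: v_def)
  have "integrable lborel v"
    unfolding v_def by (intro Bochner_Integration.integrable_sum integrable_mult_left int_cell)
  then show "integrable lborel (\<lambda>t. indicator (cell \<delta>) t *\<^sub>R u k t)"
    unfolding u_eq by simp
  have integral_v: "integral\<^sup>L lborel v = (\<Sum>p\<in>freq_box K. \<Sum>q\<in>freq_box K.
      integral\<^sup>L lborel (\<lambda>t. indicator (cell \<delta>) t *\<^sub>R (a t q * b t (p - q))) * dft_char K k p)"
    unfolding v_def
    by (subst Bochner_Integration.integral_sum,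
        intro Bochner_Integration.integrable_sum integrable_mult_left int_cell,
        intro sum.cong refl,
        subst Bochner_Integration.integral_sum, intro integrable_mult_left int_cell,
        simp only: integral_mult_left_zero)
  have "dft K (\<lambda>p. convolution f g (lattice_pt \<delta> p - h)) k = of_real (\<delta>\<^sup>2) * integral\<^sup>L lborel v"
    by (simp only: dft_def \<delta>_def[symmetric] conv sum_distrib_right integral_v)
  also have "\<dots> = integral\<^sup>L lborel (\<lambda>t. indicator (cell \<delta>) t *\<^sub>R u k t) / of_real (\<delta>\<^sup>2)"
    unfolding u_eq using \<delta> by (simp add: power2_eq_square)
  finally show "dft K (\<lambda>p. convolution f g (lattice_pt \<delta> p - h)) k =
      integral\<^sup>L lborel (\<lambda>t. indicator (cell \<delta>) t *\<^sub>R u k t) / of_real (\<delta>\<^sup>2)" .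
qed

section \<open>Comparison of the two sums\<close>

text \<open>The Cauchy-Schwarz inequality, after pulling out the uniform bound on the
  weights.\<close>

lemma sum_weighted_product_le:
  assumes "\<And>k. k \<in> B \<Longrightarrow> norm (w k) \<le> W" and "W \<ge> 0"
  shows "norm (\<Sum>k\<in>B. w k * (x k * y k)) \<le>
    W * (L2_set (\<lambda>k. norm (x k)) B * L2_set (\<lambda>k. norm (y k :: 'a::real_normed_div_algebra)) B)"
proof -
  have "norm (\<Sum>k\<in>B. w k * (x k * y k)) \<le> (\<Sum>k\<in>B. W * (\<bar>norm (x k)\<bar> * \<bar>norm (y k)\<bar>))"
    by (rule sum_norm_le) (auto simp: norm_mult intro!: mult_right_mono assms(1))
  also have "\<dots> \<le> W * (L2_set (\<lambda>k. norm (x k)) B * L2_set (\<lambda>k. norm (y k)) B)"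
    unfolding sum_distrib_left[symmetric] by (intro mult_left_mono L2_set_mult_ineq assms(2))
  finally show ?thesis .
qed

text \<open>Here \<open>a\<close>, \<open>b\<close> are samples on the grid and \<open>a'\<close>,
  \<open>b'\<close> samples of translates. The first sum carries the phase twice, once per
  transform, and the second only once, since the convolution is transformed as a single
  function.\<close>

lemma dft_product_diff_le:
  assumes c: "\<And>k. norm (c k) \<le> C" "\<And>k. norm (c k) * freq_norm k \<le> C" and C: "C \<ge> 0"
    and a: "\<And>p. norm (a p) \<le> M" "\<And>p. norm (a' p) \<le> M" "\<And>p. norm (a p - a' p) \<le> d"
    and b: "\<And>p. norm (b p) \<le> N" "\<And>p. norm (b p - b' p) \<le> e"
    and nonneg: "M \<ge> 0" "N \<ge> 0" "d \<ge> 0" "e \<ge> 0"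
  shows "norm ((\<Sum>k\<in>freq_box K. c k * (half_phase K k * dft K a k) * (half_phase K k * dft K b k)) -
      (\<Sum>k\<in>freq_box K. c k * half_phase K k * (dft K a' k * dft K b' k)))
    \<le> 16 * C * (2 * pi * M * N / real (2 * K + 1) + d * N + M * e)"
proof -
  let ?B = "freq_box K" and ?w = "half_phase K" and ?T = "dft K"
  let ?n = "\<lambda>\<phi>. L2_set (\<lambda>k. norm (\<phi> k)) ?B"
  \<comment> \<open>Bounds the coefficient times the phase error: the factor
    \<open>freq_norm k\<close> of the latter is paid for by the decay of \<open>c\<close>.\<close>
  define \<epsilon> where "\<epsilon> = 2 * pi * C / real (2 * K + 1)"
  have \<epsilon>0: "\<epsilon> \<ge> 0" using C by (simp add: \<epsilon>_def)
  have w1: "norm (c k * ?w k * (?w k - 1)) \<le> \<epsilon>" for k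
  proof -
    have "norm (c k * ?w k * (?w k - 1)) \<le> norm (c k) * (2 * pi * freq_norm k / real (2 * K + 1))"
      unfolding norm_mult norm_half_phase mult_1_right by (intro mult_left_mono norm_half_phase_minus_1_le) simp
    also have "\<dots> = 2 * pi / real (2 * K + 1) * (norm (c k) * freq_norm k)" by simp
    also have "\<dots> \<le> 2 * pi / real (2 * K + 1) * C" by (intro mult_left_mono c) simp
    finally show ?thesis by (simp add: \<epsilon>_def)
  qed
  have w2: "norm (c k * ?w k) \<le> C" for k using c(1) by (simp add: norm_mult)
  define S1 where "S1 = (\<Sum>k\<in>?B. c k * ?w k * (?w k - 1) * (?T a k * ?T b k))"
  define S2 where "S2 = (\<Sum>k\<in>?B. c k * ?w k * (?T (\<lambda>p. a p - a' p) k * ?T b k))"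
  define S3 where "S3 = (\<Sum>k\<in>?B. c k * ?w k * (?T a' k * ?T (\<lambda>p. b p - b' p) k))"
  \<comment> \<open>Telescoping: first drop one phase, then replace \<open>a\<close> by
    \<open>a'\<close>, then \<open>b\<close> by \<open>b'\<close>. Each of the three sums has two
    factors controlled in l2 by \<open>L2_dft_le\<close>, whence the constant 16 = 4 * 4.\<close>
  have split: "c k * (?w k * ?T a k) * (?w k * ?T b k) - c k * ?w k * (?T a' k * ?T b' k) =
      c k * ?w k * (?w k - 1) * (?T a k * ?T b k) +
      (c k * ?w k * (?T (\<lambda>p. a p - a' p) k * ?T b k) + c k * ?w k * (?T a' k * ?T (\<lambda>p. b p - b' p) k))" for k
    unfolding dft_diff by algebra
  have "(\<Sum>k\<in>?B. c k * (?w k * ?T a k) * (?w k * ?T b k)) - (\<Sum>k\<in>?B. c k * ?w k * (?T a' k * ?T b' k)) =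
      S1 + (S2 + S3)" (is "?D = _")
    by (simp only: S1_def S2_def S3_def split flip: sum_subtractf sum.distrib)
  then have "norm ?D = norm (S1 + (S2 + S3))" by (rule arg_cong)
  also have "\<dots> \<le> norm S1 + (norm S2 + norm S3)"
    by (intro order_trans[OF norm_triangle_ineq] add_left_mono norm_triangle_ineq)
  also have "\<dots> \<le> \<epsilon> * (?n (?T a) * ?n (?T b)) +
      (C * (?n (?T (\<lambda>p. a p - a' p)) * ?n (?T b)) + C * (?n (?T a') * ?n (?T (\<lambda>p. b p - b' p))))"
    unfolding S1_def S2_def S3_def
    by (intro add_mono sum_weighted_product_le[OF w1 \<epsilon>0] sum_weighted_product_le[OF w2 C])
  also have "\<dots> \<le> \<epsilon> * ((4 * M) * (4 * N)) + (C * ((4 * d) * (4 * N)) + C * ((4 * M) * (4 * e)))"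
  proof -
    have L: "?n (?T a) \<le> 4 * M" "?n (?T a') \<le> 4 * M" "?n (?T (\<lambda>p. a p - a' p)) \<le> 4 * d"
      "?n (?T b) \<le> 4 * N" "?n (?T (\<lambda>p. b p - b' p)) \<le> 4 * e"
      using a b nonneg by (simp_all add: L2_dft_le)
    have "?n (?T a) * ?n (?T b) \<le> (4 * M) * (4 * N)"
      "?n (?T (\<lambda>p. a p - a' p)) * ?n (?T b) \<le> (4 * d) * (4 * N)"
      "?n (?T a') * ?n (?T (\<lambda>p. b p - b' p)) \<le> (4 * M) * (4 * e)"
      using nonneg by (simp_all only: mult_mono[OF L(1) L(4)] mult_mono[OF L(3) L(4)]
          mult_mono[OF L(2) L(5)] L2_set_nonneg mult_nonneg_nonneg zero_le_numeral)
    then show ?thesis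
      by (intro add_mono mult_left_mono[OF _ \<epsilon>0] mult_left_mono[OF _ C])
  qed
  also have "\<dots> = 16 * C * (2 * pi * M * N / real (2 * K + 1) + d * N + M * e)"
    by (simp add: \<epsilon>_def algebra_simps)
  finally show ?thesis .
qed

text \<open>The coefficient of the convolution is the average of \<open>U t\<close> over the cell,
  and the constant \<open>V\<close> is its own average. A bound on \<open>V - U t\<close> uniform in
  the cell therefore bounds the difference.\<close>

lemma disk_coef_error_le:
  fixes f g :: "real \<times> real \<Rightarrow> complex" and K :: nat
  assumes f: "continuous_on UNIV f" "supp f \<subseteq> cball 0 (1 / 2)"
    and g: "continuous_on UNIV g" "supp g \<subseteq> cball 0 (1 / 2)" and K: "K \<ge> 3"
    and M: "\<And>x. norm (f x) \<le> M" "\<And>x y. norm (f x - f y) \<le> M * (\<bar>fst x - fst y\<bar> + \<bar>snd x - snd y\<bar>)"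
    and N: "\<And>x. norm (g x) \<le> N" "\<And>x y. norm (g x - g y) \<le> N * (\<bar>fst x - fst y\<bar> + \<bar>snd x - snd y\<bar>)"
    and nonneg: "M \<ge> 0" "N \<ge> 0" "C \<ge> 0"
    and C: "\<And>k. norm (coef m n k) \<le> C" "\<And>k. norm (coef m n k) * freq_norm k \<le> C"
  shows "norm (disk_coef_conv m n K f g - disk_coef m n K (convolution f g)) \<le>
    16 * C * M * N * (2 * pi + 10) / real (2 * K + 1)"
proof -
  define \<delta> where "\<delta> = 2 / real (2 * K + 1)"
  have \<delta>: "\<delta> > 0" by (simp add: \<delta>_def)
  define h where "h = (\<delta> / 2, \<delta> / 2)"
  define a where "a = (\<lambda>t q. f (lattice_pt \<delta> q + t))"
  define b where "b = (\<lambda>t r. g (lattice_pt \<delta> r - h - t))"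
  define a0 where "a0 = (\<lambda>q. f (lattice_pt \<delta> q - h))"
  define b0 where "b0 = (\<lambda>q. g (lattice_pt \<delta> q - h))"
  define c where "c = coef m n"
  define u where "u = (\<lambda>k t. dft K (a t) k * dft K (b t) k)"
  define U where "U = (\<lambda>t. \<Sum>k\<in>freq_box K. c k * half_phase K k * u k t)"
  define V where "V = (\<Sum>k\<in>freq_box K. c k * (half_phase K k * dft K a0 k) * (half_phase K k * dft K b0 k))"
  \<comment> \<open>The term 2 pi comes from the phase, and 10 = 2 * (3 + 2) from the displacements
    \<open>3 * \<delta>\<close> of \<open>f\<close> and \<open>2 * \<delta>\<close> of
    \<open>g\<close>, with \<open>\<delta>\<close> being 2 / L.\<close>
  define E where "E = 16 * C * M * N * (2 * pi + 10) / real (2 * K + 1)"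
  note conv = dft_convolution_samples[OF f g K, folded \<delta>_def, folded h_def]
  have int_u: "integrable lborel (\<lambda>t. indicator (cell \<delta>) t *\<^sub>R u k t)" for k
    using conv(1)[of k] by (simp add: u_def a_def b_def)
  have dft_H: "dft K (\<lambda>p. convolution f g (lattice_pt \<delta> p - h)) k =
      integral\<^sup>L lborel (\<lambda>t. indicator (cell \<delta>) t *\<^sub>R u k t) / of_real (\<delta>\<^sup>2)" for k
    using conv(2)[of k] by (simp add: u_def a_def b_def)
  have U_eq: "indicator (cell \<delta>) t *\<^sub>R U t =
      (\<Sum>k\<in>freq_box K. c k * half_phase K k * (indicator (cell \<delta>) t *\<^sub>R u k t))" for t
    by (simp add: U_def scaleR_sum_right)
  have int_U: "integrable lborel (\<lambda>t. indicator (cell \<delta>) t *\<^sub>R U t)"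
    unfolding U_eq by (intro Bochner_Integration.integrable_sum integrable_mult_right int_u)
  have int_V: "integrable lborel (\<lambda>t. indicator (cell \<delta>) t *\<^sub>R V)"
    and integral_V: "integral\<^sup>L lborel (\<lambda>t. indicator (cell \<delta>) t *\<^sub>R V) = of_real (\<delta>\<^sup>2) * V"
    using integrable_cell[of \<delta>] integral_cell[of \<delta>] \<delta>
    by (auto simp: integral_scaleR_left scaleR_conv_of_real[of "\<delta>\<^sup>2"])
  have "disk_coef m n K (convolution f g) =
      (\<Sum>k\<in>freq_box K. c k * half_phase K k * integral\<^sup>L lborel (\<lambda>t. indicator (cell \<delta>) t *\<^sub>R u k t)) / of_real (\<delta>\<^sup>2)"
    unfolding disk_coef_def finite_fourier_eq_dft \<delta>_def[symmetric] h_def[symmetric] dft_H c_def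
    by (simp add: sum_divide_distrib mult_ac)
  also have "\<dots> = integral\<^sup>L lborel (\<lambda>t. indicator (cell \<delta>) t *\<^sub>R U t) / of_real (\<delta>\<^sup>2)"
    unfolding U_eq
    by (subst Bochner_Integration.integral_sum)
      (intro integrable_mult_right int_u, simp only: integral_mult_right_zero)
  finally have H: "disk_coef m n K (convolution f g) =
      integral\<^sup>L lborel (\<lambda>t. indicator (cell \<delta>) t *\<^sub>R U t) / of_real (\<delta>\<^sup>2)" .
  have "disk_coef_conv m n K f g = V"
    unfolding disk_coef_conv_def finite_fourier_eq_dft V_def
    by (simp only: \<delta>_def[symmetric] h_def[symmetric] a0_def b0_def c_def)
  also have "V = integral\<^sup>L lborel (\<lambda>t. indicator (cell \<delta>) t *\<^sub>R V) / of_real (\<delta>\<^sup>2)"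
    using \<delta> by (simp add: integral_V)
  finally have diff: "disk_coef_conv m n K f g - disk_coef m n K (convolution f g) =
      integral\<^sup>L lborel (\<lambda>t. indicator (cell \<delta>) t *\<^sub>R (V - U t)) / of_real (\<delta>\<^sup>2)"
    using int_U int_V by (simp add: H scaleR_diff_right diff_divide_distrib)
  have "norm (integral\<^sup>L lborel (\<lambda>t. indicator (cell \<delta>) t *\<^sub>R (V - U t))) \<le>
      integral\<^sup>L lborel (\<lambda>t. indicator (cell \<delta>) t * E)"
  proof (rule Bochner_Integration.integral_norm_bound_integral)
    show "integrable lborel (\<lambda>t. indicator (cell \<delta>) t *\<^sub>R (V - U t))"
      using int_U int_V by (simp add: scaleR_diff_right)
    show "integrable lborel (\<lambda>t. indicator (cell \<delta>) t * E)"
      using integrable_cell[of \<delta>] by simp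
    fix t :: "real \<times> real"
    show "norm (indicator (cell \<delta>) t *\<^sub>R (V - U t)) \<le> indicator (cell \<delta>) t * E"
    proof (cases "t \<in> cell \<delta>")
      case True
      then have t: "0 \<le> fst t" "fst t < \<delta>" "0 \<le> snd t" "snd t < \<delta>" by (auto simp: cell_def)
      \<comment> \<open>The samples of \<open>f\<close> are displaced by \<open>t + h\<close>, at
        most \<open>3 * \<delta> / 2\<close> per coordinate. Those of \<open>g\<close> below keep
        the offset \<open>h\<close> and are displaced by \<open>t\<close> alone, at most
        \<open>\<delta>\<close> per coordinate.\<close>
      have "norm (a0 p - a t p) \<le> M * (3 * \<delta>)" for p
      proof -
        have "norm (a0 p - a t p) \<le> M * (\<bar>fst t + \<delta> / 2\<bar> + \<bar>snd t + \<delta> / 2\<bar>)"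
          using M(2)[of "lattice_pt \<delta> p - h" "lattice_pt \<delta> p + t"] by (simp add: a0_def a_def h_def abs_minus_commute)
        also have "\<dots> \<le> M * (3 * \<delta>)" using t nonneg by (intro mult_left_mono) auto
        finally show ?thesis .
      qed
      moreover have "norm (b0 p - b t p) \<le> N * (2 * \<delta>)" for p
      proof -
        have "norm (b0 p - b t p) \<le> N * (\<bar>fst t\<bar> + \<bar>snd t\<bar>)"
          using N(2)[of "lattice_pt \<delta> p - h" "lattice_pt \<delta> p - h - t"] by (simp add: b0_def b_def)
        also have "\<dots> \<le> N * (2 * \<delta>)" using t nonneg by (intro mult_left_mono) auto
        finally show ?thesis .
      qed
      ultimately have "norm (V - U t) \<le>
          16 * C * (2 * pi * M * N / real (2 * K + 1) + M * (3 * \<delta>) * N + M * (N * (2 * \<delta>)))"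
        unfolding V_def U_def u_def c_def using nonneg \<delta>
        by (intro dft_product_diff_le C) (auto simp: a0_def a_def b0_def b_def M(1) N(1))
      also have "\<dots> = E"
        by (simp add: E_def \<delta>_def algebra_simps add_divide_distrib)
      finally show ?thesis using True by simp
    qed simp
  qed
  also have "integral\<^sup>L lborel (\<lambda>t. indicator (cell \<delta>) t * E) = \<delta>\<^sup>2 * E"
    unfolding integral_mult_left_zero integral_cell[OF less_imp_le[OF \<delta>]] ..
  finally have "norm (integral\<^sup>L lborel (\<lambda>t. indicator (cell \<delta>) t *\<^sub>R (V - U t))) \<le> \<delta>\<^sup>2 * E" .
  then show ?thesis
    unfolding diff E_def[symmetric] norm_divide norm_of_real abs_power2
    using \<delta> by (simp add: divide_le_eq mult.commute)
qed

theorem mainTheorem7: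
  fixes f g :: "real \<times> real \<Rightarrow> complex" and m :: int and n :: nat
  assumes "C1_plane f" and "C1_plane g"
    and "supp f \<subseteq> cball 0 (1 / 2)" and "supp g \<subseteq> cball 0 (1 / 2)"
    and "n \<ge> 1"
  shows "\<exists>A>0. \<forall>K::nat. K \<ge> 1 \<longrightarrow>
    norm (disk_coef_conv m n K f g - disk_coef m n K (convolution f g)) \<le> A / real K"
proof -
  let ?e = "\<lambda>K. norm (disk_coef_conv m n K f g - disk_coef m n K (convolution f g))"
  obtain M where M: "M \<ge> 0" "\<And>x. norm (f x) \<le> M"
    "\<And>x y. norm (f x - f y) \<le> M * (\<bar>fst x - fst y\<bar> + \<bar>snd x - snd y\<bar>)"
    using C1_plane_lipschitz[OF assms(1) compact_cball assms(3)] by blast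
  obtain N where N: "N \<ge> 0" "\<And>x. norm (g x) \<le> N"
    "\<And>x y. norm (g x - g y) \<le> N * (\<bar>fst x - fst y\<bar> + \<bar>snd x - snd y\<bar>)"
    using C1_plane_lipschitz[OF assms(2) compact_cball assms(4)] by blast
  obtain C where C: "C \<ge> 0" "\<And>k. norm (coef m n k) \<le> C" "\<And>k. norm (coef m n k) * freq_norm k \<le> C"
    using coef_bound by blast
  define A0 where "A0 = 16 * C * M * N * (2 * pi + 10)"
  have A0: "A0 \<ge> 0" using C(1) M(1) N(1) by (simp add: A0_def)
  have cont: "continuous_on UNIV f" "continuous_on UNIV g"
    using assms(1,2) by (auto simp: C1_plane_def)
  have large: "?e K \<le> A0 / real K" if "K \<ge> 3" for K
  proof -
    have "?e K \<le> A0 / real (2 * K + 1)"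
      unfolding A0_def
      by (rule disk_coef_error_le[OF cont(1) assms(3) cont(2) assms(4) that M(2,3) N(2,3) M(1) N(1) C])
    also have "\<dots> \<le> A0 / real K" using A0 that by (intro divide_left_mono) auto
    finally show ?thesis .
  qed
  \<comment> \<open>The two small values of \<open>K\<close> are absorbed by their own errors, the
    second one doubled because it is compared with \<open>A / 2\<close>. The final 1 makes the
    constant positive.\<close>
  define A where "A = A0 + ?e 1 + 2 * ?e 2 + 1"
  have "?e K \<le> A / real K" if "K \<ge> 1" for K
  proof (cases "K \<ge> 3")
    case True
    have "?e K \<le> A0 / real K" by (rule large[OF True])
    also have "\<dots> \<le> A / real K" by (intro divide_right_mono) (auto simp: A_def)
    finally show ?thesis .
  next
    case False
    then have "K = 1 \<or> K = 2" using that by auto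
    then show ?thesis using A0 by (auto simp: A_def field_simps)
  qed
  moreover have "A > 0" using A0 by (simp add: A_def add_nonneg_pos)
  ultimately show ?thesis by blast
qed

end
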